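(* Let $\omega = \tfrac12 + \tfrac{\sqrt{-3}}{2}$ and $\mathcal{E}_{-3} = \{ n \in \mathbb{Z}[\omega] : |n|^2 \le 1\}$. For every $n \in \mathbb{Z}[\omega] \setminus \mathcal{E}_{-3}$ there exist nonzero $a,b,c \in \mathbb{Z}[\omega]$ with $\frac{4}{n} = \frac1a + \frac1b + \frac1c$.
   Context: $\mathbb{Z}[\omega]$ is the ring of Eisenstein integers, the ring of integers of $\mathbb{Q}(\sqrt{-3})$; for $n = x + y\omega$ with $x,y\in\mathbb{Z}$, $|n|^2 = x^2 + xy + y^2$. *)

theory Defs
  imports Complex_Main
begin

definition omega :: complex where
  "omega = 1 / 2 + csqrt (- 3) / 2"

definition eisenstein_integers :: "complex set" where
  "eisenstein_integers = {of_int x + of_int y * omega | x y. True}"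

definition exceptional_set :: "complex set" where
  "exceptional_set = {n \<in> eisenstein_integers. (cmod n)\<^sup>2 \<le> 1}"

lemma omega_eq_Complex: "omega = Complex (1 / 2) (sqrt 3 / 2)"
  by (simp add: omega_def complex_eq_iff)

lemma cmod_eisenstein_squared:
  "(cmod (of_int x + of_int y * omega))\<^sup>2 = of_int (x\<^sup>2 + x * y + y\<^sup>2)"
proof -
  have "(cmod (of_int x + of_int y * omega))\<^sup>2
      = (of_int x + of_int y / 2)\<^sup>2 + (of_int y * sqrt 3 / 2)\<^sup>2"
    by (simp add: omega_eq_Complex cmod_power2)
  also have "\<dots> = of_int (x\<^sup>2 + x * y + y\<^sup>2)"
    by (simp add: power_mult_distrib power_divide) (simp add: power2_eq_square field_simps)
  finally show ?thesis .
qed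

end

theory Submission
  imports Defs
begin

text \<open>
  If \<open>n = 4 k - (u + v)\<close> with \<open>u\<close>, \<open>v\<close> units and \<open>k \<noteq> 0\<close>, then
  \<open>4 / n = 1 / k + u / (n k) + v / (n k)\<close>. Every residue class modulo \<open>4\<close> that is not divisible by
  \<open>2\<close> contains a unit multiple of \<open>1\<close> or of \<open>1 + \<omega>\<close>, and both of these are sums of two units.
  Multiples of \<open>2\<close> are trivial, and so \<open>k = 0\<close> only leaves the associates of \<open>1 + \<omega>\<close>.
\<close>

section \<open>Powers and inverses of the primitive sixth root of unity \<open>omega\<close>, a root
  of \<open>X^2 - X + 1\<close>\<close>

lemma omega_squared: "omega\<^sup>2 = omega - 1"
  by (simp add: omega_eq_Complex power2_eq_square complex_eq_iff)

lemma omega_cubed: "omega ^ 3 = - 1"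
proof -
  have "omega ^ 3 = omega * omega\<^sup>2"
    by (simp add: eval_nat_numeral)
  also have "\<dots> = omega\<^sup>2 - omega"
    by (simp add: omega_squared algebra_simps) (simp add: omega_squared flip: power2_eq_square)
  finally show ?thesis
    by (simp add: omega_squared)
qed

lemma omega_power4: "omega ^ 4 = - omega"
  using omega_cubed power_Suc[of omega 3] by simp

lemma omega_power5: "omega ^ 5 = 1 - omega"
  using omega_power4 power_Suc[of omega 4] omega_squared by (simp add: power2_eq_square)

lemma omega_power6: "omega ^ 6 = 1"
  using omega_cubed power_mult[of omega 3 2] by simp

lemma omega_nonzero: "omega \<noteq> 0"
  by (simp add: omega_eq_Complex complex_eq_iff)

lemma omega_inverse: "inverse omega = 1 - omega"
proof (rule inverse_unique)
  show "omega * (1 - omega) = 1"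
    using omega_squared by (simp add: algebra_simps power2_eq_square)
qed

lemma inverse_omega_minus_1: "inverse (omega - 1) = - omega"
  using omega_inverse by (metis inverse_inverse_eq inverse_minus_eq minus_diff_eq)

lemma cmod_omega: "cmod omega = 1"
  using power_eq_1_iff[OF omega_power6] by simp

lemma one_plus_omega_nonzero: "1 + omega \<noteq> 0"
  by (simp add: omega_eq_Complex complex_eq_iff)

section \<open>Ring structure of the Eisenstein integers and their residues modulo 4\<close>

lemma eisenstein_integersI: "of_int x + of_int y * omega \<in> eisenstein_integers"
  by (auto simp: eisenstein_integers_def)

lemma of_int_eisenstein [simp]: "of_int x \<in> eisenstein_integers"
  using eisenstein_integersI[of x 0] by simp

lemma one_eisenstein [simp]: "1 \<in> eisenstein_integers"
  using of_int_eisenstein[of 1] by simp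

lemma numeral_eisenstein [simp]: "numeral k \<in> eisenstein_integers"
  using of_int_eisenstein[of "numeral k"] by simp

lemma omega_eisenstein [simp]: "omega \<in> eisenstein_integers"
  using eisenstein_integersI[of 0 1] by simp

lemma eisenstein_add:
  assumes "a \<in> eisenstein_integers" "b \<in> eisenstein_integers"
  shows "a + b \<in> eisenstein_integers"
proof -
  from assms obtain x y z w where "a = of_int x + of_int y * omega" "b = of_int z + of_int w * omega"
    by (auto simp: eisenstein_integers_def)
  then have "a + b = of_int (x + z) + of_int (y + w) * omega"
    by (simp add: algebra_simps)
  then show ?thesis
    by (simp only: eisenstein_integersI)
qed

lemma eisenstein_mult:
  assumes "a \<in> eisenstein_integers" "b \<in> eisenstein_integers"
  shows "a * b \<in> eisenstein_integers"
proof -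
  from assms obtain x y z w where ab: "a = of_int x + of_int y * omega" "b = of_int z + of_int w * omega"
    by (auto simp: eisenstein_integers_def)
  have "a * b = of_int x * of_int z + (of_int x * of_int w + of_int y * of_int z) * omega
      + of_int y * of_int w * omega\<^sup>2"
    by (simp add: ab algebra_simps power2_eq_square)
  also have "\<dots> = of_int (x * z - y * w) + of_int (x * w + y * z + y * w) * omega"
    by (simp add: omega_squared algebra_simps)
  finally show ?thesis
    by (simp only: eisenstein_integersI)
qed

lemma eisenstein_power: "a \<in> eisenstein_integers \<Longrightarrow> a ^ i \<in> eisenstein_integers"
  by (induction i) (auto intro: eisenstein_mult)

lemma eisenstein_uminus: "a \<in> eisenstein_integers \<Longrightarrow> - a \<in> eisenstein_integers"
  using eisenstein_mult[of "of_int (- 1)" a, OF of_int_eisenstein] by simp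

lemma eisenstein_diff:
  "a \<in> eisenstein_integers \<Longrightarrow> b \<in> eisenstein_integers \<Longrightarrow> a - b \<in> eisenstein_integers"
  using eisenstein_add[OF _ eisenstein_uminus] by simp

lemmas eisenstein_closed =
  eisenstein_add eisenstein_mult eisenstein_power eisenstein_uminus eisenstein_diff

text \<open>Powers of \<open>omega\<close> are units, as \<open>inverse omega\<close> is
  \<open>1 - omega\<close>. This keeps the quotient by 4 integral when a unit is factored out of
  \<open>n\<close>.\<close>

lemma inverse_omega_power_eisenstein: "inverse (omega ^ i) \<in> eisenstein_integers"
  unfolding power_inverse[symmetric] omega_inverse by (intro eisenstein_closed) simp_all

text \<open>Four of the 16 classes modulo 4 are even. The six units and the six associates of
  \<open>1 + omega\<close> are pairwise incongruent modulo 4 and fill the other twelve. The last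
  case is named after the ramified prime 3, which \<open>1 + omega\<close> divides.\<close>

lemma eisenstein_mod_4:
  assumes "n \<in> eisenstein_integers"
  obtains (even) m where "m \<in> eisenstein_integers" "n = 2 * m"
  | (unit) m i where "m \<in> eisenstein_integers" "n = 4 * m + omega ^ i"
  | (ramified) m i where "m \<in> eisenstein_integers" "n = 4 * m + omega ^ i * (1 + omega)"
proof -
  from assms obtain x y where n: "n = of_int x + of_int y * omega"
    by (auto simp: eisenstein_integers_def)
  show thesis
  proof (cases "even x \<and> even y")
    case True
    then obtain a b where "x = 2 * a" "y = 2 * b"
      by (auto elim!: evenE)
    then have "n = 2 * (of_int a + of_int b * omega)"
      by (simp add: n algebra_simps)
    then show thesis
      using even eisenstein_integersI by blast
  next
    case False
    \<comment> \<open>Coordinates in the basis \<open>1\<close>, \<open>omega\<close>: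
      \<open>s\<close> lists \<open>omega ^ i\<close> and \<open>t\<close> lists
      \<open>omega ^ i * (1 + omega)\<close>, for \<open>i\<close> from 0 to 5.\<close>
    define s :: "(int \<times> int) set" where "s = {(1,0),(0,1),(-1,1),(-1,0),(0,-1),(1,-1)}"
    define t :: "(int \<times> int) set" where "t = {(1,1),(-1,2),(-2,1),(-1,-1),(1,-2),(2,-1)}"
    have "\<exists>(r, q) \<in> s \<union> t. 4 dvd x - r \<and> 4 dvd y - q"
      using False unfolding s_def t_def by simp presburger
    then obtain r q a b where rq: "(r, q) \<in> s \<union> t" and "x - r = 4 * a" "y - q = 4 * b"
      by (auto elim!: dvdE)
    then have "x = 4 * a + r" "y = 4 * b + q"
      by simp_all
    then have n': "n = 4 * (of_int a + of_int b * omega) + (of_int r + of_int q * omega)"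
      by (simp add: n algebra_simps)
    note pows = omega_squared omega_cubed omega_power4 omega_power5
    have "\<exists>i. of_int r + of_int q * omega = omega ^ i" if "(r, q) \<in> s"
    proof -
      have "of_int r + of_int q * omega \<in> {omega ^ 0, omega ^ 1, omega ^ 2, omega ^ 3, omega ^ 4, omega ^ 5}"
        using that unfolding pows s_def by auto
      then show ?thesis by blast
    qed
    moreover have "\<exists>i. of_int r + of_int q * omega = omega ^ i * (1 + omega)" if "(r, q) \<in> t"
    proof -
      \<comment> \<open>As a rewrite rule this brings the expanded products back to the basis
        \<open>1\<close>, \<open>omega\<close>.\<close>
      have "omega * omega = omega - 1"
        using omega_squared by (simp add: power2_eq_square)
      then have "of_int r + of_int q * omega \<in> (\<lambda>i. omega ^ i * (1 + omega)) ` {0, 1, 2, 3, 4, 5}"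
        using that unfolding image_insert pows t_def by (auto simp: algebra_simps)
      then show ?thesis by blast
    qed
    ultimately show thesis
      using rq n' unit ramified eisenstein_integersI by (metis Un_iff)
  qed
qed

section \<open>Decompositions of \<open>4 / n\<close> into three unit fractions\<close>

definition egyptian :: "complex \<Rightarrow> bool" where
  "egyptian n \<longleftrightarrow> (\<exists>a \<in> eisenstein_integers. \<exists>b \<in> eisenstein_integers. \<exists>c \<in> eisenstein_integers.
     a \<noteq> 0 \<and> b \<noteq> 0 \<and> c \<noteq> 0 \<and> 4 / n = 1 / a + 1 / b + 1 / c)"

lemma egyptianI:
  assumes "a \<in> eisenstein_integers" "b \<in> eisenstein_integers" "c \<in> eisenstein_integers"
    and "a \<noteq> 0" "b \<noteq> 0" "c \<noteq> 0" "4 / n = 1 / a + 1 / b + 1 / c"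
  shows "egyptian n"
  using assms unfolding egyptian_def by blast

text \<open>Divide the decomposition by \<open>e\<close>. With \<open>e\<close> a power of
  \<open>omega\<close>, this reduces the odd residues to \<open>1\<close> and
  \<open>1 + omega\<close>.\<close>

lemma egyptian_mult:
  assumes "egyptian n" "e \<in> eisenstein_integers" "e \<noteq> 0"
  shows "egyptian (e * n)"
proof -
  from assms(1) obtain a b c where abc:
      "a \<in> eisenstein_integers" "b \<in> eisenstein_integers" "c \<in> eisenstein_integers"
      "a \<noteq> 0" "b \<noteq> 0" "c \<noteq> 0" and eq: "4 / n = 1 / a + 1 / b + 1 / c"
    unfolding egyptian_def by blast
  have "4 / (e * n) = 1 / e * (4 / n)"
    by simp
  also have "\<dots> = 1 / (e * a) + 1 / (e * b) + 1 / (e * c)"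
    unfolding eq by (simp add: ring_distribs)
  finally show ?thesis
    using abc assms by (intro egyptianI[of "e * a" "e * b" "e * c"]) (auto intro: eisenstein_mult)
qed

text \<open>Divide \<open>eq\<close> by \<open>n * k\<close>. The units enter through their
  inverses, so that the denominators \<open>n * k * u\<close> and \<open>n * k * v\<close> are
  visibly integral.\<close>

lemma egyptian_unit_sum:
  assumes k: "k \<in> eisenstein_integers" "k \<noteq> 0" and n: "n \<in> eisenstein_integers" "n \<noteq> 0"
    and eq: "n + inverse u + inverse v = 4 * k"
    and uv: "u \<in> eisenstein_integers" "v \<in> eisenstein_integers" "u \<noteq> 0" "v \<noteq> 0"
  shows "egyptian n"
proof (rule egyptianI[of k "n * k * u" "n * k * v"])
  have "4 / n = 4 * k / (n * k)"
    using k by simp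
  also have "\<dots> = 1 / k + 1 / (n * k * u) + 1 / (n * k * v)"
    unfolding eq[symmetric] using k n by (simp add: distrib_right divide_inverse)
  finally show "4 / n = 1 / k + 1 / (n * k * u) + 1 / (n * k * v)" .
qed (use assms in \<open>auto intro: eisenstein_mult\<close>)

text \<open>The primitive cube roots of unity \<open>- omega\<close> and \<open>omega - 1\<close>
  are inverse to each other and sum to \<open>- 1\<close>, which cancels the residue.\<close>

lemma egyptian_4k_plus_1:
  assumes k: "k \<in> eisenstein_integers" "k \<noteq> 0" and "4 * k + 1 \<noteq> 0"
  shows "egyptian (4 * k + 1)"
proof (rule egyptian_unit_sum[OF k, of _ "- omega" "omega - 1"])
  show "4 * k + 1 + inverse (- omega) + inverse (omega - 1) = 4 * k"
    by (simp add: omega_inverse inverse_omega_minus_1)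
  show "omega - 1 \<noteq> 0"
    using omega_squared omega_nonzero by auto
qed (use assms omega_nonzero in \<open>auto intro!: eisenstein_closed\<close>)

text \<open>Here the residue is cancelled by \<open>- 1\<close>, its own inverse, and
  \<open>- omega\<close>, the inverse of \<open>omega - 1\<close>.\<close>

lemma egyptian_4k_plus_1_plus_omega:
  assumes k: "k \<in> eisenstein_integers" "k \<noteq> 0" and "4 * k + (1 + omega) \<noteq> 0"
  shows "egyptian (4 * k + (1 + omega))"
proof (rule egyptian_unit_sum[OF k, of _ "- 1" "omega - 1"])
  show "4 * k + (1 + omega) + inverse (- 1) + inverse (omega - 1) = 4 * k"
    by (simp add: inverse_omega_minus_1)
  show "omega - 1 \<noteq> 0"
    using omega_squared omega_nonzero by auto
qed (use assms in \<open>auto intro!: eisenstein_closed\<close>)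

lemma egyptian_1_plus_omega: "egyptian (1 + omega)"
proof (rule egyptianI[of "1 + omega" 1 omega])
  have "(1 + omega) * (2 - omega) = 3"
    using omega_squared by (simp add: algebra_simps power2_eq_square)
  then have "3 / (1 + omega) = 2 - omega"
    using one_plus_omega_nonzero by (simp add: field_simps)
  moreover have "4 / (1 + omega) = 1 / (1 + omega) + 3 / (1 + omega)"
    by (simp flip: add_divide_distrib)
  ultimately show "4 / (1 + omega) = 1 / (1 + omega) + 1 / 1 + 1 / omega"
    using omega_inverse by (simp add: inverse_eq_divide)
qed (auto intro!: eisenstein_closed simp: one_plus_omega_nonzero omega_nonzero)

lemma egyptian_even:
  assumes "m \<in> eisenstein_integers" "m \<noteq> 0"
  shows "egyptian (2 * m)"
  by (rule egyptianI[of m "2 * m" "2 * m"]) (use assms in \<open>auto intro!: eisenstein_closed\<close>)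

theorem theorem12:
  fixes n :: complex
  assumes "n \<in> eisenstein_integers - exceptional_set"
  shows "\<exists>a \<in> eisenstein_integers. \<exists>b \<in> eisenstein_integers. \<exists>c \<in> eisenstein_integers.
           a \<noteq> 0 \<and> b \<noteq> 0 \<and> c \<noteq> 0 \<and> 4 / n = 1 / a + 1 / b + 1 / c"
proof -
  have nE: "n \<in> eisenstein_integers" and norm: "(cmod n)\<^sup>2 > 1"
    using assms by (auto simp: exceptional_set_def)
  have n0: "n \<noteq> 0"
    using norm by auto
  \<comment> \<open>The unit is pulled out of the whole sum, which replaces \<open>m\<close> by its
    associate \<open>inverse (omega ^ i) * m\<close>.\<close>
  have factor: "4 * m + omega ^ i * s = omega ^ i * (4 * (inverse (omega ^ i) * m) + s)" for m i s
    using omega_nonzero by (simp add: distrib_left)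
  from nE have "egyptian n"
  proof (cases rule: eisenstein_mod_4)
    case (even m)
    then show ?thesis
      using n0 egyptian_even by simp
  next
    case (unit m i)
    define k where "k = inverse (omega ^ i) * m"
    have n: "n = omega ^ i * (4 * k + 1)"
      using unit factor[of m i 1] by (simp add: k_def)
    \<comment> \<open>Otherwise \<open>n\<close> would be a power of \<open>omega\<close>, of
      modulus 1, against \<open>norm\<close>.\<close>
    have "k \<noteq> 0"
      using norm by (auto simp: n norm_power cmod_omega)
    moreover have "k \<in> eisenstein_integers"
      unfolding k_def by (intro eisenstein_mult inverse_omega_power_eisenstein unit)
    ultimately show ?thesis
      unfolding n using n0 n omega_nonzero
      by (intro egyptian_mult egyptian_4k_plus_1 eisenstein_power) auto
  next
    case (ramified m i)
    define k where "k = inverse (omega ^ i) * m"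
    have n: "n = omega ^ i * (4 * k + (1 + omega))"
      using ramified factor by (simp add: k_def)
    have "k \<in> eisenstein_integers"
      unfolding k_def by (intro eisenstein_mult inverse_omega_power_eisenstein ramified)
    \<comment> \<open>Here \<open>k = 0\<close> is possible: the associates of
      \<open>1 + omega\<close> have norm 3 and are not exceptional.\<close>
    then have "egyptian (4 * k + (1 + omega))"
      using egyptian_1_plus_omega egyptian_4k_plus_1_plus_omega n0 n by (cases "k = 0") auto
    then show ?thesis
      unfolding n using omega_nonzero by (intro egyptian_mult eisenstein_power) auto
  qed
  then show ?thesis
    by (simp add: egyptian_def)
qed

end
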